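(* Let $F:\mathbb{R}^d\to\mathbb{R}^d$ be a vector field with set of unstable zeros $\mathcal{Z}^*$, let $G:\mathbb{R}^d\times\Xi\to\mathbb{R}^d$ be an oracle, let $\{\xi^k\}_{k\ge0}$ be a $\Xi$-valued seed sequence on $(\Omega_\xi,\mathcal{F}_\xi,\mathbb{P}_\xi)$, and suppose that the structural assumption (with threshold $\tilde\alpha$) and the stochastic oracle assumption stated in the context hold, where the step-sizes satisfy $0<\alpha_k\le\tilde\alpha$, $\alpha_k\to0$ and $\sum_{k=0}^\infty\alpha_k=\infty$. Fix $z^*\in\mathcal{Z}^*$. Then there exists $\delta_0>0$ such that, for every $\omega_\xi\in\mathcal{E}_{\rm reg}(z^* )$, there are $m_0\in\mathbb{N}$ and Lebesgue null sets $\{\mathcal{N}_m\}_{m}$ in $\mathbb{R}^d$ such that, for every $m\ge m_0$, any orbit $\{z^k\}_k$ of the recursion $z^{k+1}=z^k-\alpha_kG(z^k;\xi^k(\omega_\xi))$ with $$\|z^k-z^*\|\le\delta_0\qquad\forall\,k\ge m$$ satisfies $z^m\in\mathcal{N}_m$.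
   Context: Unstable zeros. A point $z^*\in\mathbb{R}^d$ is an unstable zero of $F$ if $F(z^* )=0$ and the derivative $\mathrm{D}F(z^* )$ has an eigenvalue with negative real part. $\mathcal{Z}^*$ is the set of all unstable zeros of $F$. Measurability. $(\Xi,\mathcal{A})$ is a measurable space, $(z,\xi)\mapsto G(z;\xi)$ is jointly measurable, and for every $z^*\in\mathcal{Z}^*$ the map $(z,\xi)\mapsto \mathrm{D}G(z;\xi)$ (derivative in $z$) is jointly measurable on $\mathcal{U}_{z^*}\times\Xi$, with $\mathcal{U}_{z^*}$ as below. Structural assumption. (Regularity) $F$ is $\mathcal{C}^1$ in a neighborhood of $\mathcal{Z}^*$. (Local equicontinuity) For every $z^*\in\mathcal{Z}^*$ there is an open neighborhood $\mathcal{U}_{z^*}$ of $z^*$ such that $G(\cdot;\xi)$ is differentiable on $\mathcal{U}_{z^*}$ for every $\xi\in\Xi$, and for every compact $\mathcal{Q}\subset\mathcal{U}_{z^*}$ and every $\varepsilon>0$ there is $\delta>0$ with $\|\mathrm{D}G(z;\xi)-\mathrm{D}G(w;\xi)\|\le\varepsilon$ for all $\xi\in\Xi$ and all $z,w\in\mathcal{Q}$ with $\|z-w\|\le\delta$. (Lipeomorphism) There is $\tilde\alpha>0$ such that for every $0<\alpha\le\tilde\alpha$ and every $\xi\in\Xi$ the map $T_{\alpha,\xi}(z):=z-\alpha G(z;\xi)$ has a well-defined inverse on $\mathbb{R}^d$ and both $T_{\alpha,\xi}$ and $T_{\alpha,\xi}^{-1}$ are locally Lipschitz. Stochastic oracle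 assumption. For every $\bar z\in\mathcal{Z}^*$, put $b_k:=G(\bar z;\xi^k)-F(\bar z)$, $J_k:=\mathrm{D}G(\bar z;\xi^k)-\mathrm{D}F(\bar z)$ and $S_k:=\sum_{i=k}^\infty\alpha_iJ_i$. There is an event $\mathcal{E}_{\rm reg}(\bar z)\in\mathcal{F}_\xi$ with $\mathbb{P}_\xi(\mathcal{E}_{\rm reg}(\bar z))=1$ on which the series defining $S_k$ converge, $S_k\to0$, $S_{k+1}J_k\to0$, and the series $\sum_{k=0}^\infty\alpha_kb_k$ and $\sum_{k=0}^\infty\alpha_kS_{k+1}b_k$ converge. The event $\mathcal{E}_{\rm reg}(z^* )$ in the claim is the one given by this assumption for $\bar z=z^*$. *)

theory Defs
  imports "HOL-Probability.Probability"
begin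

text \<open>The eigenvalues of a real matrix are the complex eigenvalues of its complexification.\<close>

definition complex_eigenvalue :: "real^'n^'n \<Rightarrow> complex \<Rightarrow> bool" where
  "complex_eigenvalue A \<mu> \<longleftrightarrow>
     (\<exists>v :: complex^'n. v \<noteq> 0 \<and> map_matrix complex_of_real A *v v = \<mu> *s v)"

text \<open>
  Differentiability is required explicitly, since \<^const>\<open>jacobian\<close> is a total function that is
  unspecified at points of non-differentiability.
\<close>

definition unstable_zeros :: "(real^'n \<Rightarrow> real^'n) \<Rightarrow> (real^'n) set" where
  "unstable_zeros F = {z. F z = 0 \<and> F differentiable (at z) \<and>
     (\<exists>\<mu>. complex_eigenvalue (jacobian F (at z)) \<mu> \<and> Re \<mu> < 0)}"

definition C1_near :: "(real^'n \<Rightarrow> real^'n) \<Rightarrow> (real^'n) set \<Rightarrow> bool" where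
  "C1_near F Z \<longleftrightarrow>
     (\<exists>W. open W \<and> Z \<subseteq> W \<and> (\<forall>z\<in>W. F differentiable (at z)) \<and>
          continuous_on W (\<lambda>z. jacobian F (at z)))"

definition DG :: "(real^'n \<Rightarrow> 'x \<Rightarrow> real^'n) \<Rightarrow> real^'n \<Rightarrow> 'x \<Rightarrow> real^'n^'n" where
  "DG G z \<xi> = jacobian (\<lambda>y. G y \<xi>) (at z)"

text \<open>
  In the following definitions the measurable space of seeds is \<^term>\<open>\<Xi> :: 'x measure\<close>, used only
  through its carrier and its sigma-algebra. Here and in \<open>oracle_measurable\<close> the same
  neighbourhoods \<open>U z\<close> of the points \<open>z\<close> in \<open>Z\<close> are used. The norm of derivatives is the operator norm.
\<close>

definition locally_equicontinuous ::
  "(real^'n \<Rightarrow> 'x \<Rightarrow> real^'n) \<Rightarrow> 'x measure \<Rightarrow> (real^'n) set \<Rightarrow> (real^'n \<Rightarrow> (real^'n) set) \<Rightarrow> bool" where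
  "locally_equicontinuous G \<Xi> Z U \<longleftrightarrow> (\<forall>z\<^sub>0\<in>Z.
     open (U z\<^sub>0) \<and> z\<^sub>0 \<in> U z\<^sub>0 \<and>
     (\<forall>\<xi>\<in>space \<Xi>. \<forall>z\<in>U z\<^sub>0. (\<lambda>y. G y \<xi>) differentiable (at z)) \<and>
     (\<forall>Q \<epsilon>. compact Q \<and> Q \<subseteq> U z\<^sub>0 \<and> \<epsilon> > 0 \<longrightarrow>
        (\<exists>\<delta>>0. \<forall>\<xi>\<in>space \<Xi>. \<forall>z\<in>Q. \<forall>w\<in>Q. norm (z - w) \<le> \<delta> \<longrightarrow>
           onorm (\<lambda>h. (DG G z \<xi> - DG G w \<xi>) *v h) \<le> \<epsilon>)))"

definition oracle_measurable ::
  "(real^'n \<Rightarrow> 'x \<Rightarrow> real^'n) \<Rightarrow> 'x measure \<Rightarrow> (real^'n) set \<Rightarrow> (real^'n \<Rightarrow> (real^'n) set) \<Rightarrow> bool" where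
  "oracle_measurable G \<Xi> Z U \<longleftrightarrow>
     (\<lambda>(z, \<xi>). G z \<xi>) \<in> borel_measurable (borel \<Otimes>\<^sub>M \<Xi>) \<and>
     (\<forall>z\<^sub>0\<in>Z. (\<lambda>(z, \<xi>). DG G z \<xi>) \<in> borel_measurable (restrict_space borel (U z\<^sub>0) \<Otimes>\<^sub>M \<Xi>))"

text \<open>
  The library notion \<^const>\<open>local_lipschitz\<close> is about families of functions; a single function is
  the family over a one-point parameter set.
\<close>

definition locally_lipschitz :: "('a::metric_space \<Rightarrow> 'b::metric_space) \<Rightarrow> bool" where
  "locally_lipschitz f \<longleftrightarrow> local_lipschitz {0::real} UNIV (\<lambda>_. f)"

definition oracle_step :: "(real^'n \<Rightarrow> 'x \<Rightarrow> real^'n) \<Rightarrow> real \<Rightarrow> 'x \<Rightarrow> real^'n \<Rightarrow> real^'n" where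
  "oracle_step G a \<xi> z = z - a *\<^sub>R G z \<xi>"

definition lipeomorphic_steps :: "(real^'n \<Rightarrow> 'x \<Rightarrow> real^'n) \<Rightarrow> 'x measure \<Rightarrow> real \<Rightarrow> bool" where
  "lipeomorphic_steps G \<Xi> \<alpha>\<^sub>t \<longleftrightarrow> \<alpha>\<^sub>t > 0 \<and>
     (\<forall>a \<xi>. 0 < a \<and> a \<le> \<alpha>\<^sub>t \<and> \<xi> \<in> space \<Xi> \<longrightarrow>
        bij (oracle_step G a \<xi>) \<and>
        locally_lipschitz (oracle_step G a \<xi>) \<and>
        locally_lipschitz (inv (oracle_step G a \<xi>)))"

definition structural_assumption ::
  "(real^'n \<Rightarrow> real^'n) \<Rightarrow> (real^'n \<Rightarrow> 'x \<Rightarrow> real^'n) \<Rightarrow> 'x measure \<Rightarrow>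
   (real^'n \<Rightarrow> (real^'n) set) \<Rightarrow> real \<Rightarrow> bool" where
  "structural_assumption F G \<Xi> U \<alpha>\<^sub>t \<longleftrightarrow>
     C1_near F (unstable_zeros F) \<and>
     locally_equicontinuous G \<Xi> (unstable_zeros F) U \<and>
     lipeomorphic_steps G \<Xi> \<alpha>\<^sub>t"

text \<open>
  In the next three definitions \<open>x\<close> is one realization of the seed sequence.
\<close>

definition noise_b ::
  "(real^'n \<Rightarrow> real^'n) \<Rightarrow> (real^'n \<Rightarrow> 'x \<Rightarrow> real^'n) \<Rightarrow> (nat \<Rightarrow> 'x) \<Rightarrow> real^'n \<Rightarrow> nat \<Rightarrow> real^'n" where
  "noise_b F G x z k = G z (x k) - F z"

definition noise_J ::
  "(real^'n \<Rightarrow> real^'n) \<Rightarrow> (real^'n \<Rightarrow> 'x \<Rightarrow> real^'n) \<Rightarrow> (nat \<Rightarrow> 'x) \<Rightarrow> real^'n \<Rightarrow> nat \<Rightarrow> real^'n^'n" where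
  "noise_J F G x z k = DG G z (x k) - jacobian F (at z)"

definition noise_S ::
  "(real^'n \<Rightarrow> real^'n) \<Rightarrow> (real^'n \<Rightarrow> 'x \<Rightarrow> real^'n) \<Rightarrow> (nat \<Rightarrow> real) \<Rightarrow> (nat \<Rightarrow> 'x) \<Rightarrow>
   real^'n \<Rightarrow> nat \<Rightarrow> real^'n^'n" where
  "noise_S F G \<alpha> x z k = (\<Sum>i. \<alpha> (k + i) *\<^sub>R noise_J F G x z (k + i))"

definition stochastic_oracle_assumption ::
  "(real^'n \<Rightarrow> real^'n) \<Rightarrow> (real^'n \<Rightarrow> 'x \<Rightarrow> real^'n) \<Rightarrow> (nat \<Rightarrow> real) \<Rightarrow>
   'w measure \<Rightarrow> (nat \<Rightarrow> 'w \<Rightarrow> 'x) \<Rightarrow> (real^'n \<Rightarrow> 'w set) \<Rightarrow> bool" where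
  "stochastic_oracle_assumption F G \<alpha> M \<xi> E \<longleftrightarrow> (\<forall>z\<in>unstable_zeros F.
     E z \<in> sets M \<and> measure M (E z) = 1 \<and>
     (\<forall>\<omega>\<in>E z.
        let b = noise_b F G (\<lambda>k. \<xi> k \<omega>) z;
            J = noise_J F G (\<lambda>k. \<xi> k \<omega>) z;
            S = noise_S F G \<alpha> (\<lambda>k. \<xi> k \<omega>) z
        in (\<forall>k. summable (\<lambda>i. \<alpha> (k + i) *\<^sub>R J (k + i))) \<and>
           S \<longlonglongrightarrow> 0 \<and>
           (\<lambda>k. S (Suc k) ** J k) \<longlonglongrightarrow> 0 \<and>
           summable (\<lambda>k. \<alpha> k *\<^sub>R b k) \<and>
           summable (\<lambda>k. \<alpha> k *\<^sub>R (S (Suc k) *v b k))))"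

end

theory Submission
  imports Defs
begin

text \<open>
  Any two orbits that stay in a small ball around \<open>z\<^sub>s\<close> differ by a sequence \<open>d\<^sub>k\<close> from which the noise
  \<open>b\<^sub>k\<close> has cancelled. With \<open>S\<^sub>k = \<alpha>\<^sub>k J\<^sub>k + S\<^sub>k\<^sub>+\<^sub>1\<close>, the change of variables \<open>e\<^sub>k = (I - S\<^sub>k) d\<^sub>k\<close> also
  removes \<open>J\<^sub>k\<close>, up to the small term \<open>\<alpha>\<^sub>k S\<^sub>k\<^sub>+\<^sub>1 J\<^sub>k d\<^sub>k\<close>, so that
  \<open>e\<^sub>k\<^sub>+\<^sub>1 = e\<^sub>k - \<alpha>\<^sub>k (A e\<^sub>k + p\<^sub>k)\<close> where \<open>A\<close> is the Jacobian of \<open>F\<close> at \<open>z\<^sub>s\<close> and \<open>p\<^sub>k\<close> is small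
  relative to \<open>e\<^sub>k\<close>. Since \<open>A\<close> has an eigenvalue with negative real part, a Lyapunov equation gives
  a quadratic form \<open>Q\<close>, positive somewhere, and \<open>\<tau> > 0\<close> with \<open>Q e\<^sub>k\<^sub>+\<^sub>1 \<ge> (1 + \<tau> \<alpha>\<^sub>k) Q e\<^sub>k\<close>. The step sizes are
  not summable, so a positive value of \<open>Q\<close> would force the bounded sequence \<open>e\<close> to be unbounded.
  Hence two trapped starting points never differ by a positive multiple of a fixed vector \<open>v\<close> with
  \<open>Q v > 0\<close>: the closed bounded set of trapped points has infinitely many disjoint translates inside
  one ball, and is null.
\<close>

section \<open>Eigenvalues of linear maps and the Lyapunov equation\<close>

text \<open>Eigenvectors for distinct eigenvalues are linearly independent, so the dimension bounds
  their number. The space is a general Euclidean one because the lemma is applied to an operator on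
  matrices.\<close>

lemma finite_eigenvalues:
  fixes f :: "'a::euclidean_space \<Rightarrow> 'a"
  assumes "linear f"
  shows "finite {\<tau>. \<exists>x. x \<noteq> 0 \<and> f x = \<tau> *\<^sub>R x}" (is "finite ?E")
proof (rule ccontr)
  interpret linear f by fact
  assume "infinite ?E"
  then obtain T where T: "finite T" "card T = Suc DIM('a)" "T \<subseteq> ?E"
    using infinite_arbitrarily_large[OF \<open>infinite ?E\<close>, of "Suc DIM('a)"] by auto
  define g where "g \<tau> = (SOME x. x \<noteq> 0 \<and> f x = \<tau> *\<^sub>R x)" for \<tau>
  have g: "g \<tau> \<noteq> 0" "f (g \<tau>) = \<tau> *\<^sub>R g \<tau>" if "\<tau> \<in> ?E" for \<tau>
    using someI_ex[of "\<lambda>x. x \<noteq> 0 \<and> f x = \<tau> *\<^sub>R x"] that by (auto simp: g_def)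
  have indep: "\<forall>\<tau>\<in>R. c \<tau> = 0"
    if "finite R" "R \<subseteq> ?E" "(\<Sum>\<tau>\<in>R. c \<tau> *\<^sub>R g \<tau>) = 0" for R c
    using that
  proof (induction R arbitrary: c rule: finite_induct)
    case (insert s R)
    \<comment> \<open>Applying \<open>f\<close> to the relation and subtracting \<open>s\<close>
      times the relation removes \<open>g s\<close> and multiplies each remaining coefficient by
      \<open>\<tau> - s\<close>, which is nonzero on \<open>R\<close>.\<close>
    let ?X = "\<lambda>c. \<Sum>\<tau>\<in>R. c \<tau> *\<^sub>R g \<tau>"
    have s: "c s *\<^sub>R g s + ?X c = 0" using insert by simp
    have eig: "f (g \<tau>) = \<tau> *\<^sub>R g \<tau>" if "\<tau> \<in> insert s R" for \<tau>
      using g(2) insert.prems(1) that by blast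
    have "f (?X c) = ?X (\<lambda>\<tau>. c \<tau> * \<tau>)"
      unfolding sum scale by (intro sum.cong) (simp_all add: eig)
    moreover have "f (c s *\<^sub>R g s + ?X c) = (c s * s) *\<^sub>R g s + f (?X c)"
      by (simp add: add scale eig)
    ultimately have "(c s * s) *\<^sub>R g s + ?X (\<lambda>\<tau>. c \<tau> * \<tau>) = 0"
      by (simp only: s zero)
    moreover have "(c s * s) *\<^sub>R g s + s *\<^sub>R ?X c = 0"
      using arg_cong[OF s, of "scaleR s"] by (simp add: scaleR_add_right mult.commute)
    moreover have "?X (\<lambda>\<tau>. c \<tau> * (\<tau> - s)) = ?X (\<lambda>\<tau>. c \<tau> * \<tau>) - s *\<^sub>R ?X c"
      by (simp add: scaleR_sum_right sum_subtractf[symmetric] scaleR_diff_left right_diff_distrib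
          mult.commute)
    ultimately have "?X (\<lambda>\<tau>. c \<tau> * (\<tau> - s)) = 0"
      by (metis (no_types, lifting) add_left_cancel right_minus_eq)
    then have "\<forall>\<tau>\<in>R. c \<tau> * (\<tau> - s) = 0"
      using insert.IH[of "\<lambda>\<tau>. c \<tau> * (\<tau> - s)"] insert.prems by auto
    then have R: "\<forall>\<tau>\<in>R. c \<tau> = 0" using insert.hyps by auto
    then have "c s *\<^sub>R g s = 0" using s by simp
    then show ?case using R g insert.prems by auto
  qed simp
  have inj: "inj_on g T"
  proof (rule inj_onI)
    fix s t assume "s \<in> T" "t \<in> T" "g s = g t"
    moreover from this have "s \<in> ?E" "t \<in> ?E" using T(3) by blast+
    ultimately have "s *\<^sub>R g s = t *\<^sub>R g s" "g s \<noteq> 0"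
      using g(2)[of s] g(2)[of t] g(1)[of s] by presburger+
    then show "s = t" by simp
  qed
  have "independent (g ` T)"
  proof (rule independent_if_scalars_zero)
    fix u x assume "(\<Sum>x\<in>g ` T. u x *\<^sub>R x) = 0" "x \<in> g ` T"
    then show "u x = 0"
      using indep[OF T(1,3), of "\<lambda>\<tau>. u (g \<tau>)"] by (auto simp: sum.reindex inj)
  qed (simp add: T)
  then show False using independent_card_le[of "g ` T"] T card_image[OF inj] by simp
qed

lemma lyapunov_form:
  fixes A :: "real^'n^'n"
  assumes "complex_eigenvalue A \<mu>" "Re \<mu> < 0"
  obtains H :: "real^'n^'n" and \<tau> v where "\<tau> > 0" "v \<bullet> (H *v v) > 0"
    "\<And>x. x \<bullet> (H *v (A *v x)) + (A *v x) \<bullet> (H *v x) = - (\<tau> * (x \<bullet> (H *v x)) + x \<bullet> x)"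
proof -
  \<comment> \<open>\<open>L\<close> has only finitely many eigenvalues, so \<open>L H + \<tau> H = - I\<close> is solvable for all but finitely
    many shifts \<open>\<tau>\<close>; no information about the spectrum of \<open>A\<close> is needed.\<close>
  define L where "L H = H ** A + transpose A ** H" for H :: "real^'n^'n"
  have L: "linear L"
  proof (rule linearI)
    show "L (X + Y) = L X + L Y" for X Y
      unfolding L_def by (simp add: matrix_add_ldistrib)
        (simp add: vec_eq_iff matrix_matrix_mult_def sum.distrib distrib_right)
    show "L (c *\<^sub>R X) = c *\<^sub>R L X" for c X
      unfolding L_def by (simp add: scaleR_add_right scalar_matrix_assoc matrix_scalar_ac)
  qed
  \<comment> \<open>The shift has two duties: \<open>\<tau> > 0\<close> gives growth of the form,
    and \<open>\<tau> < - 2 * Re \<mu>\<close> will make the form positive on an eigenvector. This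
    open window is infinite, so it contains a non-eigenvalue \<open>\<sigma> = - \<tau>\<close> of
    \<open>L\<close>.\<close>
  have "infinite {2 * Re \<mu> <..< 0}" using assms(2) by simp
  then have "\<not> {2 * Re \<mu> <..< 0} \<subseteq> {\<tau>. \<exists>x. x \<noteq> 0 \<and> L x = \<tau> *\<^sub>R x}"
    using finite_eigenvalues[OF L] finite_subset by blast
  then obtain \<sigma> where \<sigma>: "2 * Re \<mu> < \<sigma>" "\<sigma> < 0" "\<And>x. L x = \<sigma> *\<^sub>R x \<Longrightarrow> x = 0"
    unfolding subset_iff mem_Collect_eq greaterThanLessThan_iff by blast
  define \<tau> where "\<tau> = - \<sigma>"
  have \<tau>: "0 < \<tau>" "\<tau> < - 2 * Re \<mu>" "\<And>x. L x = - \<tau> *\<^sub>R x \<Longrightarrow> x = 0"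
    using \<sigma> by (simp_all add: \<tau>_def)
  have lin: "linear (\<lambda>x. L x + \<tau> *\<^sub>R x)"
    using L by (simp add: linear_compose_add linear_scale_self)
  moreover have "inj (\<lambda>x. L x + \<tau> *\<^sub>R x)"
    unfolding linear_injective_0[OF lin] using \<tau>(3)
    by (metis eq_neg_iff_add_eq_0 scaleR_minus_left)
  ultimately have "surj (\<lambda>x. L x + \<tau> *\<^sub>R x)" by (rule linear_inj_imp_surj)
  from surjD[OF this, of "- mat 1"]
  obtain H where "L H + \<tau> *\<^sub>R H = - mat 1" by auto
  then have H: "L H = - (\<tau> *\<^sub>R H + mat 1)" by (simp add: eq_neg_iff_add_eq_0 algebra_simps)
  have eq: "x \<bullet> (H *v (A *v x)) + (A *v x) \<bullet> (H *v x) = - (\<tau> * (x \<bullet> (H *v x)) + x \<bullet> x)" for x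
  proof -
    have "(A *v x) \<bullet> (H *v x) = x \<bullet> (transpose A *v (H *v x))"
      by (metis dot_lmul_matrix inner_commute transpose_transpose vector_transpose_matrix)
    then have "x \<bullet> (H *v (A *v x)) + (A *v x) \<bullet> (H *v x) = x \<bullet> (L H *v x)"
      unfolding L_def by (simp add: matrix_vector_mult_add_rdistrib inner_add_right matrix_vector_mul_assoc)
    also have "\<dots> = - (\<tau> * (x \<bullet> (H *v x)) + x \<bullet> x)"
    proof -
      have "- (\<tau> *\<^sub>R H + mat 1) *v x = - (\<tau> *\<^sub>R (H *v x) + x)"
        using matrix_vector_mult_diff_rdistrib[of 0 "\<tau> *\<^sub>R H + mat 1" x]
        by (simp add: matrix_vector_mult_add_rdistrib scaleR_matrix_vector_assoc)
      then show ?thesis unfolding H by (simp add: inner_add_right inner_diff_right)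
    qed
    finally show ?thesis .
  qed
  obtain w where w: "w \<noteq> 0" "map_matrix complex_of_real A *v w = \<mu> *s w"
    using assms(1) unfolding complex_eigenvalue_def by blast
  define a b :: "real^'n" where "a = (\<chi> i. Re (w $ i))" and "b = (\<chi> i. Im (w $ i))"
  have Aa: "A *v a = Re \<mu> *\<^sub>R a - Im \<mu> *\<^sub>R b" and Ab: "A *v b = Re \<mu> *\<^sub>R b + Im \<mu> *\<^sub>R a"
  proof -
    have eig: "(\<Sum>j\<in>UNIV. complex_of_real (A $ i $ j) * w $ j) = \<mu> * w $ i" for i
      using arg_cong[OF w(2), of "\<lambda>x. x $ i"]
      by (simp add: matrix_vector_mult_def map_matrix_def)
    show "A *v a = Re \<mu> *\<^sub>R a - Im \<mu> *\<^sub>R b" "A *v b = Re \<mu> *\<^sub>R b + Im \<mu> *\<^sub>R a"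
      using arg_cong[OF eig, of Re] arg_cong[OF eig, of Im]
      by (simp_all add: vec_eq_iff matrix_vector_mult_def a_def b_def)
  qed
  \<comment> \<open>When the identities for the real part \<open>a\<close> and the imaginary part
    \<open>b\<close> of the eigenvector are added, the cross terms carrying \<open>Im \<mu>\<close>
    cancel.\<close>
  have "(- 2 * Re \<mu> - \<tau>) * (a \<bullet> (H *v a) + b \<bullet> (H *v b)) = a \<bullet> a + b \<bullet> b"
    using eq[of a] eq[of b]
    by (simp add: Aa Ab algebra_simps inner_diff_right inner_diff_left inner_add_left inner_add_right)
  moreover have "a \<noteq> 0 \<or> b \<noteq> 0"
    using w(1) by (auto simp: a_def b_def vec_eq_iff complex_eq_iff)
  then have "a \<bullet> a + b \<bullet> b > 0"
    by (metis add_nonneg_pos add_pos_nonneg inner_ge_zero inner_gt_zero_iff)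
  ultimately have "a \<bullet> (H *v a) + b \<bullet> (H *v b) > 0"
    using \<tau>(2) by (metis diff_gt_0_iff_gt zero_less_mult_pos)
  then have "a \<bullet> (H *v a) > 0 \<or> b \<bullet> (H *v b) > 0" by linarith
  then show ?thesis using that[OF \<tau>(1) _ eq] by blast
qed

section \<open>Growth of a quadratic form along perturbed steps\<close>

text \<open>In the expansion of the form, the surplus \<open>x \<bullet> x\<close> of the Lyapunov
  identity pays for all errors: a quarter for each of the two cross terms with \<open>p\<close>,
  which fixes \<open>\<eta>\<close>, and a half for the second-order term, which fixes the bound on
  \<open>a\<close>.\<close>

lemma quadratic_form_step:
  fixes H B :: "'a::real_inner \<Rightarrow> 'a"
  assumes H: "bounded_linear H" and B: "bounded_linear B"
    and eq: "\<And>x. x \<bullet> H (B x) + B x \<bullet> H x = \<tau> * (x \<bullet> H x) + x \<bullet> x"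
  obtains \<eta> a\<^sub>0 where "\<eta> > 0" "a\<^sub>0 > 0"
    "\<And>a x p. 0 < a \<Longrightarrow> a \<le> a\<^sub>0 \<Longrightarrow> norm p \<le> \<eta> * norm x \<Longrightarrow>
       (1 + a * \<tau>) * (x \<bullet> H x) \<le> (x + a *\<^sub>R (B x - p)) \<bullet> H (x + a *\<^sub>R (B x - p))"
proof -
  obtain h where h: "h > 0" "\<And>x. norm (H x) \<le> norm x * h"
    using bounded_linear.pos_bounded[OF H] by blast
  obtain K where K: "K > 0" "\<And>x. norm (B x) \<le> norm x * K"
    using bounded_linear.pos_bounded[OF B] by blast
  interpret H: bounded_linear H by fact
  define \<eta> where "\<eta> = 1 / (4 * h)"
  define a\<^sub>0 where "a\<^sub>0 = 1 / (2 * h * (K + \<eta>)\<^sup>2)"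
  have pos: "\<eta> > 0" using h by (simp add: \<eta>_def)
  then have pos': "a\<^sub>0 > 0" using h K by (simp add: a\<^sub>0_def)
  have "(1 + a * \<tau>) * (x \<bullet> H x) \<le> (x + a *\<^sub>R (B x - p)) \<bullet> H (x + a *\<^sub>R (B x - p))"
    if a: "0 < a" "a \<le> a\<^sub>0" and p: "norm p \<le> \<eta> * norm x" for a x p
  proof -
    define y where "y = B x - p"
    have inner_H: "\<bar>u \<bullet> H w\<bar> \<le> h * (norm u * norm w)" for u w
    proof -
      have "\<bar>u \<bullet> H w\<bar> \<le> norm u * norm (H w)" by (rule Cauchy_Schwarz_ineq2)
      also have "\<dots> \<le> norm u * (norm w * h)" by (intro mult_left_mono h(2)) simp
      finally show ?thesis by (simp add: mult_ac)
    qed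
    have y: "norm y \<le> (K + \<eta>) * norm x"
      using norm_triangle_ineq4[of "B x" p] K(2)[of x] p by (simp add: y_def algebra_simps)
    have "h * (norm x * norm p) \<le> h * (norm x * (\<eta> * norm x))"
      using p h by (intro mult_left_mono) auto
    also have "\<dots> = (x \<bullet> x) / 4"
      using h by (simp add: \<eta>_def dot_square_norm power2_eq_square)
    finally have "h * (norm x * norm p) \<le> (x \<bullet> x) / 4" .
    then have xp: "\<bar>x \<bullet> H p\<bar> \<le> (x \<bullet> x) / 4" "\<bar>p \<bullet> H x\<bar> \<le> (x \<bullet> x) / 4"
      using inner_H[of x p] inner_H[of p x] by (simp_all add: mult_ac)
    have "a * \<bar>y \<bullet> H y\<bar> \<le> a\<^sub>0 * (h * (((K + \<eta>) * norm x) * ((K + \<eta>) * norm x)))"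
      using inner_H[of y y] a h y pos' order.trans[OF norm_ge_zero y]
      by (intro mult_mono order.trans[OF inner_H] mult_left_mono) auto
    also have "\<dots> = (x \<bullet> x) / 2"
      using h K pos by (simp add: a\<^sub>0_def dot_square_norm power2_eq_square divide_simps)
    finally have yy: "- (x \<bullet> x) / 2 \<le> a * (y \<bullet> H y)"
      using a(1) abs_ge_minus_self[of "a * (y \<bullet> H y)"] by (simp add: abs_mult)
    have "(x + a *\<^sub>R y) \<bullet> H (x + a *\<^sub>R y) =
        x \<bullet> H x + a * ((x \<bullet> H (B x) + B x \<bullet> H x) - x \<bullet> H p - p \<bullet> H x + a * (y \<bullet> H y))"
      by (simp add: y_def H.add H.diff H.scale inner_simps algebra_simps)
    also have "\<dots> \<ge> x \<bullet> H x + a * (\<tau> * (x \<bullet> H x))"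
      unfolding eq using xp yy a by (intro add_left_mono mult_left_mono) (auto simp: field_simps)
    finally show ?thesis by (simp add: y_def algebra_simps)
  qed
  then show ?thesis using that pos pos' by blast
qed

text \<open>The form grows at least linearly in the partial sums of \<open>\<alpha>\<close>, which
  diverge, while a bound on \<open>e\<close> would bound the form.\<close>

lemma unbounded_if_form_grows:
  fixes H :: "'a::real_inner \<Rightarrow> 'a" and e :: "nat \<Rightarrow> 'a"
  assumes H: "bounded_linear H" and "\<tau> > 0"
    and \<alpha>: "\<And>k. 0 < \<alpha> k" "filterlim (\<lambda>n. \<Sum>k<n. \<alpha> k) at_top sequentially"
    and step: "\<And>k. k \<ge> m \<Longrightarrow> (1 + \<alpha> k * \<tau>) * (e k \<bullet> H (e k)) \<le> e (Suc k) \<bullet> H (e (Suc k))"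
    and init: "e m \<bullet> H (e m) > 0"
  shows "\<not> (\<forall>k\<ge>m. norm (e k) \<le> R)"
proof
  assume R: "\<forall>k\<ge>m. norm (e k) \<le> R"
  obtain h where h: "h > 0" "\<And>x. norm (H x) \<le> norm x * h"
    using bounded_linear.pos_bounded[OF H] by blast
  define q where "q k = e k \<bullet> H (e k)" for k
  \<comment> \<open>The second conjunct is what makes each increment at least
    \<open>\<alpha> k * \<tau> * q m\<close>.\<close>
  have lower: "q k \<ge> q m * (1 + \<tau> * (\<Sum>j=m..<k. \<alpha> j)) \<and> q k \<ge> q m" if "k \<ge> m" for k
    using that
  proof (induction k rule: dec_induct)
    case (step k)
    have "\<alpha> k * \<tau> * q m \<le> \<alpha> k * \<tau> * q k"
      using step.IH \<alpha>(1)[of k] \<open>\<tau> > 0\<close> by (intro mult_left_mono) auto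
    moreover have "(1 + \<alpha> k * \<tau>) * q k \<le> q (Suc k)"
      using assms(5)[of k] step.hyps by (simp add: q_def)
    moreover have "0 \<le> \<alpha> k * \<tau> * q m" using init \<alpha>(1)[of k] \<open>\<tau> > 0\<close> by (simp add: q_def)
    ultimately show ?case
      using step by (simp add: algebra_simps)
  qed simp
  have upper: "q k \<le> R * R * h" if "k \<ge> m" for k
  proof -
    have "q k \<le> norm (e k) * norm (H (e k))" unfolding q_def by (rule norm_cauchy_schwarz)
    also have "\<dots> \<le> norm (e k) * (norm (e k) * h)" by (intro mult_left_mono h) simp
    also have "\<dots> \<le> R * (R * h)"
      using R that h(1) order.trans[OF norm_ge_zero] by (intro mult_mono) auto
    finally show ?thesis by simp
  qed
  have "q m > 0" using init by (simp add: q_def)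
  let ?C = "(\<Sum>j<m. \<alpha> j) + R * R * h / (q m * \<tau>)"
  have "eventually (\<lambda>n. ?C < (\<Sum>k<n. \<alpha> k)) sequentially"
    using \<alpha>(2) by (simp add: filterlim_at_top_dense)
  then obtain n where n: "n \<ge> m" "?C < (\<Sum>k<n. \<alpha> k)"
    unfolding eventually_sequentially by (metis nat_le_linear)
  have "(\<Sum>k<n. \<alpha> k) = (\<Sum>j<m. \<alpha> j) + (\<Sum>j=m..<n. \<alpha> j)"
    using n(1) by (simp add: lessThan_atLeast0 sum.atLeastLessThan_concat)
  then have "R * R * h / (q m * \<tau>) < (\<Sum>j=m..<n. \<alpha> j)" using n(2) by simp
  then have "R * R * h < q m * (\<tau> * (\<Sum>j=m..<n. \<alpha> j))"
    using \<open>q m > 0\<close> \<open>\<tau> > 0\<close> by (simp add: divide_simps mult_ac)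
  also have "\<dots> < q m * (1 + \<tau> * (\<Sum>j=m..<n. \<alpha> j))" using \<open>q m > 0\<close> by simp
  also have "\<dots> \<le> q n" using lower n(1) by simp
  finally show False using upper[OF n(1)] by simp
qed

section \<open>A criterion for null sets\<close>

text \<open>The shifts \<open>v / (i + 1)\<close> are bounded by \<open>norm v\<close>, so the
  translates of \<open>S\<close> share a ball. Two of them could meet only if points of
  \<open>S\<close> differed by a positive multiple of \<open>v\<close>. Hence every multiple of the
  measure of \<open>S\<close> is at most that of the ball.\<close>

lemma negligible_if_thin_in_direction:
  fixes S :: "'a::euclidean_space set"
  assumes S: "S \<in> lmeasurable" "bounded S"
    and thin: "\<And>x t. x \<in> S \<Longrightarrow> t > 0 \<Longrightarrow> x + t *\<^sub>R v \<notin> S"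
  shows "negligible S"
proof -
  define c where "c i = (1 / real (Suc i)) *\<^sub>R v" for i
  obtain R where R: "\<And>x. x \<in> S \<Longrightarrow> norm x \<le> R" using S(2) bounded_iff by blast
  let ?C = "cball (0::'a) (R + norm v)"
  have disj: "disjoint_family (\<lambda>i. (+) (c i) ` S)"
  proof -
    have "(+) (c i) ` S \<inter> (+) (c j) ` S = {}" if "i < j" for i j
    proof (rule ccontr)
      assume "(+) (c i) ` S \<inter> (+) (c j) ` S \<noteq> {}"
      then obtain x y where xy: "x \<in> S" "y \<in> S" "c i + x = c j + y" by auto
      then have "y = x + (1 / real (Suc i) - 1 / real (Suc j)) *\<^sub>R v"
        by (simp add: c_def algebra_simps)
      then show False using thin[OF xy(1)] xy(2) that by (auto simp: divide_simps)
    qed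
    then show ?thesis unfolding disjoint_family_on_def by (metis Int_commute nat_neq_iff)
  qed
  have sub: "(+) (c i) ` S \<subseteq> ?C" for i
  proof clarsimp
    fix x assume "x \<in> S"
    have "norm (c i) \<le> norm v" by (simp add: c_def divide_simps mult_left_le_one_le mult_le_cancel_left1)
    then show "norm (c i + x) \<le> R + norm v"
      using norm_triangle_ineq[of "c i" x] R[OF \<open>x \<in> S\<close>] by linarith
  qed
  have le: "real n * measure lebesgue S \<le> measure lebesgue ?C" for n
  proof -
    have "real n * measure lebesgue S = (\<Sum>i<n. measure lebesgue ((+) (c i) ` S))"
      by (simp add: measure_translation)
    also have "\<dots> = measure lebesgue (\<Union>i<n. (+) (c i) ` S)"
      using disj S(1)
      by (intro measure_finite_Union[symmetric])
        (auto simp: disjoint_family_on_def fmeasurableD measurable_translation emeasure_eq_measure2)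
    also have "\<dots> \<le> measure lebesgue ?C"
      using sub S(1) by (intro measure_mono_fmeasurable)
        (auto intro!: fmeasurableD measurable_translation sets.finite_UN)
    finally show ?thesis .
  qed
  have "measure lebesgue S = 0"
  proof (rule ccontr)
    assume "measure lebesgue S \<noteq> 0"
    then have "measure lebesgue S > 0" by (simp add: zero_less_measure_iff)
    then obtain n where "real n * measure lebesgue S > measure lebesgue ?C"
      using reals_Archimedean3 by blast
    then show False using le[of n] by simp
  qed
  then show ?thesis using S(1) by (simp add: negligible_iff_measure)
qed

section \<open>The conjugated recursion\<close>

lemma norm_matrix_vector_mult_le: "norm (A *v x) \<le> norm A * norm (x :: real^'n)"
  for A :: "real^'n^'m"
proof -
  have "norm (A *v x) = L2_set (\<lambda>i. norm ((A *v x) $ i)) UNIV" by (rule norm_vec_def)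
  also have "\<dots> \<le> L2_set (\<lambda>i. norm (A $ i) * norm x) UNIV"
    by (intro L2_set_mono) (auto simp: matrix_vector_mul_component Cauchy_Schwarz_ineq2)
  also have "\<dots> = norm A * norm x" by (simp add: L2_set_left_distrib norm_vec_def)
  finally show ?thesis .
qed

text \<open>Since \<open>S' = S - a J\<close>, the term \<open>a J d\<close> produced by
  \<open>- S' d\<close> cancels the one in the step. Afterwards \<open>J\<close> occurs only in the
  product \<open>S' ** J\<close>, so no bound on \<open>J\<close> alone appears.\<close>

lemma conjugated_step:
  fixes A J S S' :: "real^'n^'n" and d r :: "real^'n"
  assumes S: "S = a *\<^sub>R J + S'"
    and d': "d' = d - a *\<^sub>R (A *v d + J *v d + r)"
    and e: "e = d - S *v d"
    and s: "norm S \<le> s" "norm S' \<le> s" "norm (S' ** J) \<le> s" "norm r \<le> s * norm d" "s \<le> 1 / 2"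
  obtains p where "d' - S' *v d' = e + a *\<^sub>R (- (A *v e) - p)"
    "norm p \<le> (4 * norm A + 6) * s * norm e"
proof
  let ?p = "A *v (S *v d) - (S' ** J) *v d - S' *v (A *v d) + (r - S' *v r)"
  show "d' - S' *v d' = e + a *\<^sub>R (- (A *v e) - ?p)"
    by (simp add: d' e S algebra_simps matrix_vector_mul_assoc[symmetric]
        scaleR_matrix_vector_assoc[symmetric])
  have "s \<ge> 0" using s(1) norm_ge_zero order.trans by blast
  have mono: "norm (X *v y) \<le> c * b" if "norm X \<le> c" "norm y \<le> b" for X :: "real^'n^'n" and y c b
    using that by (meson mult_mono norm_ge_zero norm_matrix_vector_mult_le order.trans)
  have "norm (S *v d) \<le> s * norm d" using s by (intro mono) auto
  also have "\<dots> \<le> 1 / 2 * norm d" using s by (intro mult_right_mono) auto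
  \<comment> \<open>Estimates relative to \<open>d\<close> thus become estimates relative to
    \<open>e\<close>, at the price of the factor 2 that turns \<open>2 * norm A + 3\<close> into
    \<open>4 * norm A + 6\<close>.\<close>
  finally have de: "norm d \<le> 2 * norm e" using norm_triangle_ineq2[of d "S *v d"] by (simp add: e)
  have "norm (A *v (S *v d)) \<le> norm A * (s * norm d)"
    "norm ((S' ** J) *v d) \<le> s * norm d"
    "norm (S' *v (A *v d)) \<le> s * (norm A * norm d)"
    using s by (intro mono; simp)+
  moreover have "norm (S' *v r) \<le> s * norm d"
  proof -
    have "norm (S' *v r) \<le> 1 / 2 * (s * norm d)" using s by (intro mono) auto
    also have "\<dots> \<le> s * norm d" using \<open>s \<ge> 0\<close> by simp
    finally show ?thesis .
  qed
  moreover have "norm ?p \<le> norm (A *v (S *v d)) + norm ((S' ** J) *v d) + norm (S' *v (A *v d))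
      + (norm r + norm (S' *v r))"
    by (intro norm_triangle_mono norm_triangle_ineq4 order.trans[OF norm_triangle_ineq4] add_right_mono)
  ultimately have "norm ?p \<le> (2 * norm A + 3) * s * norm d"
    using s(4) by (simp add: algebra_simps)
  also have "\<dots> \<le> (2 * norm A + 3) * s * (2 * norm e)"
    using de \<open>s \<ge> 0\<close> by (intro mult_left_mono) auto
  finally show "norm ?p \<le> (4 * norm A + 6) * s * norm e" by (simp add: algebra_simps)
qed

section \<open>Trapped orbits and linearization of the oracle\<close>

text \<open>Writing the orbit as a function of its state at time \<open>m\<close> turns trapped
  orbits into a set of starting points. The step index is the absolute time
  \<open>m + j\<close>.\<close>

primrec iterate_from :: "(nat \<Rightarrow> 'a \<Rightarrow> 'a) \<Rightarrow> nat \<Rightarrow> nat \<Rightarrow> 'a \<Rightarrow> 'a" where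
  "iterate_from T m 0 x = x"
| "iterate_from T m (Suc j) x = T (m + j) (iterate_from T m j x)"

lemma iterate_from_eq:
  assumes "\<And>k. k \<ge> m \<Longrightarrow> z (Suc k) = T k (z k)"
  shows "iterate_from T m j (z m) = z (m + j)"
  by (induction j) (simp_all add: assms)

text \<open>This is an intersection of preimages of \<open>C\<close> under continuous maps.
  Closedness later supplies measurability of the set of trapped points.\<close>

lemma closed_iterate_from:
  fixes T :: "nat \<Rightarrow> 'a::topological_space \<Rightarrow> 'a"
  assumes "\<And>k. k \<ge> m \<Longrightarrow> continuous_on UNIV (T k)" "closed C"
  shows "closed {x. \<forall>j. iterate_from T m j x \<in> C}"
proof -
  have "continuous_on UNIV (iterate_from T m j)" for j
    by (induction j)
      (auto simp: continuous_on_id intro!: continuous_on_compose2[OF assms(1)])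
  then have "closed (iterate_from T m j -` C)" for j
    using assms(2) by (simp add: closed_vimage)
  then have "closed (\<Inter>j. iterate_from T m j -` C)" by blast
  also have "(\<Inter>j. iterate_from T m j -` C) = {x. \<forall>j. iterate_from T m j x \<in> C}" by auto
  finally show ?thesis .
qed

lemma trapped_difference:
  fixes A H :: "real^'n^'n" and J S :: "nat \<Rightarrow> real^'n^'n" and g :: "nat \<Rightarrow> real^'n \<Rightarrow> real^'n"
  assumes expand: "\<And>a x p. 0 < a \<Longrightarrow> a \<le> a\<^sub>0 \<Longrightarrow> norm p \<le> \<eta> * norm x \<Longrightarrow>
       (1 + a * \<tau>) * (x \<bullet> (H *v x))
         \<le> (x + a *\<^sub>R (- (A *v x) - p)) \<bullet> (H *v (x + a *\<^sub>R (- (A *v x) - p)))"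
    and "\<tau> > 0"
    and \<alpha>: "\<And>k. 0 < \<alpha> k" "filterlim (\<lambda>n. \<Sum>k<n. \<alpha> k) at_top sequentially" "\<And>k. k \<ge> m \<Longrightarrow> \<alpha> k \<le> a\<^sub>0"
    and S: "\<And>k. S k = \<alpha> k *\<^sub>R J k + S (Suc k)" "\<And>k. k \<ge> m \<Longrightarrow> norm (S k) \<le> s"
      "\<And>k. k \<ge> m \<Longrightarrow> norm (S (Suc k) ** J k) \<le> s"
    and s: "s \<le> 1 / 2" "(4 * norm A + 6) * s \<le> \<eta>"
    and g: "\<And>k u w. u \<in> C \<Longrightarrow> w \<in> C \<Longrightarrow> norm (g k u - g k w - (A + J k) *v (u - w)) \<le> s * norm (u - w)"
    and "bounded C"
    and y: "\<And>k. k \<ge> m \<Longrightarrow> y k \<in> C \<and> y (Suc k) = y k - \<alpha> k *\<^sub>R g k (y k)"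
    and z: "\<And>k. k \<ge> m \<Longrightarrow> z k \<in> C \<and> z (Suc k) = z k - \<alpha> k *\<^sub>R g k (z k)"
    and e: "\<And>k. e k = (y k - z k) - S k *v (y k - z k)"
  shows "e m \<bullet> (H *v e m) \<le> 0"
proof (rule ccontr)
  assume "\<not> e m \<bullet> (H *v e m) \<le> 0"
  then have init: "e m \<bullet> (H *v e m) > 0" by simp
  have step: "(1 + \<alpha> k * \<tau>) * (e k \<bullet> (H *v e k)) \<le> e (Suc k) \<bullet> (H *v e (Suc k))" if k: "k \<ge> m" for k
  proof -
    \<comment> \<open>The oracle enters only through a difference of its values, so the additive
      noise is gone; \<open>?r\<close> is the linearization error on \<open>C\<close>.\<close>
    let ?d = "y k - z k" and ?r = "g k (y k) - g k (z k) - (A + J k) *v (y k - z k)"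
    have d': "y (Suc k) - z (Suc k) = ?d - \<alpha> k *\<^sub>R (A *v ?d + J k *v ?d + ?r)"
      using y[OF k] z[OF k] by (simp add: matrix_vector_mult_add_rdistrib algebra_simps)
    have r: "norm ?r \<le> s * norm ?d" using g y[OF k] z[OF k] by blast
    obtain p where p: "e (Suc k) = e k + \<alpha> k *\<^sub>R (- (A *v e k) - p)"
      "norm p \<le> (4 * norm A + 6) * s * norm (e k)"
      using conjugated_step[OF S(1)[of k] d' e[of k] S(2)[OF k] S(2) S(3)[OF k] r s(1)] k
      by (metis e le_SucI)
    have "norm p \<le> \<eta> * norm (e k)" using p(2) s(2) by (meson mult_right_mono norm_ge_zero order.trans)
    then show ?thesis using expand[of "\<alpha> k" p "e k"] \<alpha>(1)[of k] \<alpha>(3)[OF k] by (simp add: p(1))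
  qed
  obtain R where R: "\<And>u. u \<in> C \<Longrightarrow> norm u \<le> R" using \<open>bounded C\<close> bounded_iff by blast
  have "norm (e k) \<le> 4 * R" if k: "k \<ge> m" for k
  proof -
    have d: "norm (y k - z k) \<le> 2 * R"
      using norm_triangle_ineq4[of "y k" "z k"] R[of "y k"] R[of "z k"] y[OF k] z[OF k] by linarith
    have "norm (S k *v (y k - z k)) \<le> norm (S k) * norm (y k - z k)"
      by (rule norm_matrix_vector_mult_le)
    also have "\<dots> \<le> 1 * norm (y k - z k)" using S(2)[OF k] s(1) by (intro mult_right_mono) auto
    finally show ?thesis
      using norm_triangle_ineq4[of "y k - z k" "S k *v (y k - z k)"] d by (simp add: e)
  qed
  then show False
    using unbounded_if_form_grows[where H = "(*v) H" and m = m and e = e, OF _ \<open>\<tau> > 0\<close> \<alpha>(1,2) step init]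
    by blast
qed

lemma noise_S_rec:
  assumes "\<And>k. summable (\<lambda>i. \<alpha> (k + i) *\<^sub>R noise_J F G x z (k + i))"
  shows "noise_S F G \<alpha> x z k = \<alpha> k *\<^sub>R noise_J F G x z k + noise_S F G \<alpha> x z (Suc k)"
  using suminf_split_head[OF assms[of k]] by (simp add: noise_S_def algebra_simps)

text \<open>The mean value inequality on the convex ball is applied to the oracle minus its
  derivative at the centre; the derivative of this difference has operator norm at most
  \<open>\<epsilon>\<close>.\<close>

lemma linearization_error:
  fixes G :: "real^'n \<Rightarrow> 'x \<Rightarrow> real^'n"
  assumes diff: "\<And>z. z \<in> cball z\<^sub>s \<delta> \<Longrightarrow> (\<lambda>y. G y \<xi>) differentiable (at z)"
    and close: "\<And>z. z \<in> cball z\<^sub>s \<delta> \<Longrightarrow> onorm (\<lambda>h. (DG G z \<xi> - DG G z\<^sub>s \<xi>) *v h) \<le> \<epsilon>"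
    and uw: "u \<in> cball z\<^sub>s \<delta>" "w \<in> cball z\<^sub>s \<delta>"
  shows "norm (G u \<xi> - G w \<xi> - DG G z\<^sub>s \<xi> *v (u - w)) \<le> \<epsilon> * norm (u - w)"
proof -
  let ?f = "\<lambda>y. G y \<xi> - DG G z\<^sub>s \<xi> *v y"
  have "norm (?f u - ?f w) \<le> \<epsilon> * norm (u - w)"
  proof (rule differentiable_bound[OF convex_cball _ close uw])
    fix z assume z: "z \<in> cball z\<^sub>s \<delta>"
    have "((\<lambda>y. G y \<xi>) has_derivative (\<lambda>h. DG G z \<xi> *v h)) (at z within cball z\<^sub>s \<delta>)"
      using diff[OF z] unfolding jacobian_works DG_def by (rule has_derivative_at_withinI)
    then show "(?f has_derivative (\<lambda>h. (DG G z \<xi> - DG G z\<^sub>s \<xi>) *v h)) (at z within cball z\<^sub>s \<delta>)"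
      unfolding matrix_vector_mult_diff_rdistrib
      by (intro has_derivative_diff bounded_linear_imp_has_derivative) auto
  qed
  then show ?thesis by (simp add: matrix_vector_mult_diff_distrib algebra_simps)
qed

section \<open>Assembly of the theorem\<close>

theorem theorem2p13:
  fixes F :: "real^'n \<Rightarrow> real^'n"
    and G :: "real^'n \<Rightarrow> 'x \<Rightarrow> real^'n"
    and \<Xi> :: "'x measure"
    and U :: "real^'n \<Rightarrow> (real^'n) set"
    and M :: "'w measure"
    and \<xi> :: "nat \<Rightarrow> 'w \<Rightarrow> 'x"
    and E\<^sub>r\<^sub>e\<^sub>g :: "real^'n \<Rightarrow> 'w set"
    and \<alpha> :: "nat \<Rightarrow> real"
    and \<alpha>\<^sub>t :: real
    and z\<^sub>s :: "real^'n"
  assumes "prob_space M"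
    and "\<And>k. \<xi> k \<in> measurable M \<Xi>"
    and "oracle_measurable G \<Xi> (unstable_zeros F) U"
    and "structural_assumption F G \<Xi> U \<alpha>\<^sub>t"
    and "stochastic_oracle_assumption F G \<alpha> M \<xi> E\<^sub>r\<^sub>e\<^sub>g"
    and "\<And>k. 0 < \<alpha> k" and "\<And>k. \<alpha> k \<le> \<alpha>\<^sub>t"
    and "\<alpha> \<longlonglongrightarrow> 0"
    and "filterlim (\<lambda>n. \<Sum>k<n. \<alpha> k) at_top sequentially"
    and "z\<^sub>s \<in> unstable_zeros F"
  shows "\<exists>\<delta>\<^sub>0>0. \<forall>\<omega>\<in>E\<^sub>r\<^sub>e\<^sub>g z\<^sub>s. \<exists>(m\<^sub>0::nat) (N :: nat \<Rightarrow> (real^'n) set).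
           (\<forall>m. N m \<in> null_sets lebesgue) \<and>
           (\<forall>m\<ge>m\<^sub>0. \<forall>z :: nat \<Rightarrow> real^'n.
              (\<forall>k. z (Suc k) = z k - \<alpha> k *\<^sub>R G (z k) (\<xi> k \<omega>)) \<and>
              (\<forall>k\<ge>m. norm (z k - z\<^sub>s) \<le> \<delta>\<^sub>0) \<longrightarrow> z m \<in> N m)"
proof -
  define A where "A = jacobian F (at z\<^sub>s)"
  obtain \<mu> where "complex_eigenvalue A \<mu>" "Re \<mu> < 0"
    using assms(10) unfolding unstable_zeros_def A_def by blast
  then obtain H \<tau> v where "\<tau> > 0" and v: "v \<bullet> (H *v v) > 0"
    and form: "\<And>x. x \<bullet> (H *v (A *v x)) + (A *v x) \<bullet> (H *v x) = - (\<tau> * (x \<bullet> (H *v x)) + x \<bullet> x)"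
    using lyapunov_form by metis
  have neg: "H *v (- x) = - (H *v x)" for x by (rule linear_neg) simp
  obtain \<eta> a\<^sub>0 where "\<eta> > 0" "a\<^sub>0 > 0"
    and expand: "\<And>a x p. 0 < a \<Longrightarrow> a \<le> a\<^sub>0 \<Longrightarrow> norm p \<le> \<eta> * norm x \<Longrightarrow>
       (1 + a * \<tau>) * (x \<bullet> (H *v x))
         \<le> (x + a *\<^sub>R (- (A *v x) - p)) \<bullet> (H *v (x + a *\<^sub>R (- (A *v x) - p)))"
  proof (rule quadratic_form_step[of "(*v) H" "\<lambda>x. - (A *v x)" \<tau>])
    show "x \<bullet> (H *v - (A *v x)) + - (A *v x) \<bullet> (H *v x) = \<tau> * (x \<bullet> (H *v x)) + x \<bullet> x" for x
      using form[of x] by (simp add: neg)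
  qed (auto intro: bounded_linear_minus)
  \<comment> \<open>The bound 1/2 serves the conjugation; the other bound brings the perturbation of
    the conjugated step below the tolerance \<open>\<eta>\<close>.\<close>
  define s where "s = min (1 / 2) (\<eta> / (4 * norm A + 6))"
  have den: "4 * norm A + 6 > 0" using norm_ge_zero[of A] by linarith
  have s: "s > 0" "s \<le> 1 / 2" "(4 * norm A + 6) * s \<le> \<eta>"
  proof -
    show "s > 0" using \<open>\<eta> > 0\<close> den by (simp add: s_def)
    show "s \<le> 1 / 2" unfolding s_def by (rule min.cobounded1)
    have "s \<le> \<eta> / (4 * norm A + 6)" by (simp add: s_def)
    then show "(4 * norm A + 6) * s \<le> \<eta>" using den by (simp add: pos_le_divide_eq mult.commute)
  qed
  note structural = assms(4)[unfolded structural_assumption_def]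
  have U: "open (U z\<^sub>s)" "z\<^sub>s \<in> U z\<^sub>s"
    and diff: "\<And>\<zeta> z. \<zeta> \<in> space \<Xi> \<Longrightarrow> z \<in> U z\<^sub>s \<Longrightarrow> (\<lambda>y. G y \<zeta>) differentiable (at z)"
    and equi: "\<And>Q \<epsilon>. compact Q \<Longrightarrow> Q \<subseteq> U z\<^sub>s \<Longrightarrow> \<epsilon> > 0 \<Longrightarrow>
        (\<exists>\<delta>>0. \<forall>\<zeta>\<in>space \<Xi>. \<forall>z\<in>Q. \<forall>w\<in>Q. norm (z - w) \<le> \<delta> \<longrightarrow>
           onorm (\<lambda>h. (DG G z \<zeta> - DG G w \<zeta>) *v h) \<le> \<epsilon>)"
    using structural assms(10) unfolding locally_equicontinuous_def by blast+
  obtain \<rho> where \<rho>: "\<rho> > 0" "cball z\<^sub>s \<rho> \<subseteq> U z\<^sub>s" using U open_contains_cball by blast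
  obtain \<delta> where \<delta>: "\<delta> > 0"
    "\<And>\<zeta> z w. \<zeta> \<in> space \<Xi> \<Longrightarrow> z \<in> cball z\<^sub>s \<rho> \<Longrightarrow> w \<in> cball z\<^sub>s \<rho> \<Longrightarrow> norm (z - w) \<le> \<delta> \<Longrightarrow>
           onorm (\<lambda>h. (DG G z \<zeta> - DG G w \<zeta>) *v h) \<le> s"
    using equi[OF compact_cball \<rho>(2) s(1)] by blast
  \<comment> \<open>Equicontinuity is uniform over the seeds, so this radius is fixed before
    \<open>\<omega>\<close>, as the order of quantifiers demands.\<close>
  define \<delta>\<^sub>0 where "\<delta>\<^sub>0 = min \<rho> \<delta>"
  have "\<delta>\<^sub>0 > 0" using \<rho> \<delta> by (simp add: \<delta>\<^sub>0_def)
  define C where "C = cball z\<^sub>s \<delta>\<^sub>0"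
  have lip: "norm (G u \<zeta> - G w \<zeta> - DG G z\<^sub>s \<zeta> *v (u - w)) \<le> s * norm (u - w)"
    if "\<zeta> \<in> space \<Xi>" "u \<in> C" "w \<in> C" for \<zeta> u w
  proof (rule linearization_error)
    show "u \<in> cball z\<^sub>s \<delta>\<^sub>0" "w \<in> cball z\<^sub>s \<delta>\<^sub>0" using that by (simp_all add: C_def)
    fix z assume "z \<in> cball z\<^sub>s \<delta>\<^sub>0"
    then have z: "z \<in> cball z\<^sub>s \<rho>" "norm (z - z\<^sub>s) \<le> \<delta>"
      by (simp_all add: \<delta>\<^sub>0_def dist_norm norm_minus_commute)
    show "(\<lambda>y. G y \<zeta>) differentiable (at z)" using diff that(1) z(1) \<rho>(2) by blast
    show "onorm (\<lambda>h. (DG G z \<zeta> - DG G z\<^sub>s \<zeta>) *v h) \<le> s" using \<delta>(2) that(1) z \<rho>(1) by simp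
  qed
  have "\<exists>m\<^sub>0 N. (\<forall>m. N m \<in> null_sets lebesgue) \<and>
           (\<forall>m\<ge>m\<^sub>0. \<forall>z :: nat \<Rightarrow> real^'n.
              (\<forall>k. z (Suc k) = z k - \<alpha> k *\<^sub>R G (z k) (\<xi> k \<omega>)) \<and>
              (\<forall>k\<ge>m. norm (z k - z\<^sub>s) \<le> \<delta>\<^sub>0) \<longrightarrow> z m \<in> N m)"
    if \<omega>: "\<omega> \<in> E\<^sub>r\<^sub>e\<^sub>g z\<^sub>s" for \<omega>
  proof -
    define J where "J = noise_J F G (\<lambda>k. \<xi> k \<omega>) z\<^sub>s"
    define S where "S = noise_S F G \<alpha> (\<lambda>k. \<xi> k \<omega>) z\<^sub>s"
    note noise = assms(5)[unfolded stochastic_oracle_assumption_def, rule_format, OF assms(10)]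
    have "\<And>k. summable (\<lambda>i. \<alpha> (k + i) *\<^sub>R J (k + i))" and S_lim: "S \<longlonglongrightarrow> 0" "(\<lambda>k. S (Suc k) ** J k) \<longlonglongrightarrow> 0"
      using noise \<omega> unfolding J_def S_def Let_def by blast+
    then have S_rec: "S k = \<alpha> k *\<^sub>R J k + S (Suc k)" for k
      unfolding J_def S_def by (intro noise_S_rec)
    have "\<omega> \<in> space M" using noise \<omega> sets.sets_into_space by blast
    then have \<xi>: "\<xi> k \<omega> \<in> space \<Xi>" for k using assms(2) measurable_space by metis
    have AJ: "A + J k = DG G z\<^sub>s (\<xi> k \<omega>)" for k by (simp add: A_def J_def noise_J_def)
    define T where "T k = oracle_step G (\<alpha> k) (\<xi> k \<omega>)" for k
    have T: "continuous_on UNIV (T k)" for k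
    proof -
      have "locally_lipschitz (T k)"
        using structural assms(6)[of k] assms(7)[of k] \<xi>[of k]
        unfolding lipeomorphic_steps_def T_def by blast
      then show ?thesis unfolding locally_lipschitz_def by (rule local_lipschitz_continuous_on) simp
    qed
    \<comment> \<open>Conjugation turns the direction \<open>v\<close> into
      \<open>v - S k *v v\<close>; its limit is \<open>v\<close>, so the form is positive on it for
      all late \<open>k\<close>.\<close>
    have "(\<lambda>k. v - S k *v v) \<longlonglongrightarrow> v - 0"
    proof (intro tendsto_diff tendsto_const Lim_null_comparison[of "\<lambda>k. S k *v v"])
      show "\<forall>\<^sub>F k in sequentially. norm (S k *v v) \<le> norm (S k) * norm v"
        by (simp add: norm_matrix_vector_mult_le)
      show "(\<lambda>k. norm (S k) * norm v) \<longlonglongrightarrow> 0"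
        using tendsto_mult_right[OF tendsto_norm_zero[OF S_lim(1)], of "norm v"] by simp
    qed
    then have "(\<lambda>k. (v - S k *v v) \<bullet> (H *v (v - S k *v v))) \<longlonglongrightarrow> v \<bullet> (H *v v)"
      by (intro tendsto_inner bounded_linear.tendsto[OF matrix_vector_mul_bounded_linear]) simp_all
    then have "eventually (\<lambda>k. (v - S k *v v) \<bullet> (H *v (v - S k *v v)) > 0) sequentially"
      using v by (rule order_tendstoD)
    moreover have "eventually (\<lambda>k. norm (S k) < s) sequentially"
      "eventually (\<lambda>k. norm (S (Suc k) ** J k) < s) sequentially"
      using order_tendstoD(2)[OF tendsto_norm_zero[OF S_lim(1)] s(1)]
        order_tendstoD(2)[OF tendsto_norm_zero[OF S_lim(2)] s(1)] by simp_all
    moreover have "eventually (\<lambda>k. \<alpha> k < a\<^sub>0) sequentially"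
      using order_tendstoD(2)[OF assms(8) \<open>a\<^sub>0 > 0\<close>] .
    ultimately have "eventually (\<lambda>k. (v - S k *v v) \<bullet> (H *v (v - S k *v v)) > 0 \<and>
        norm (S k) \<le> s \<and> norm (S (Suc k) ** J k) \<le> s \<and> \<alpha> k \<le> a\<^sub>0) sequentially"
      by eventually_elim simp
    then obtain m\<^sub>0 where m\<^sub>0: "\<And>k. k \<ge> m\<^sub>0 \<Longrightarrow> (v - S k *v v) \<bullet> (H *v (v - S k *v v)) > 0 \<and>
        norm (S k) \<le> s \<and> norm (S (Suc k) ** J k) \<le> s \<and> \<alpha> k \<le> a\<^sub>0"
      unfolding eventually_sequentially by blast
    define W where "W m = {x. \<forall>j. iterate_from T m j x \<in> C}" for m
    have null: "W m \<in> null_sets lebesgue" if m: "m \<ge> m\<^sub>0" for m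
    proof -
      have "W m \<subseteq> C" unfolding W_def by (auto dest: spec[of _ 0])
      then have bdd: "bounded (W m)" unfolding C_def using bounded_cball bounded_subset by blast
      moreover have "closed (W m)"
        unfolding W_def C_def by (intro closed_iterate_from T closed_cball)
      ultimately have "W m \<in> lmeasurable" by (simp add: lmeasurable_compact compact_eq_bounded_closed)
      moreover have "x + t *\<^sub>R v \<notin> W m" if x: "x \<in> W m" and t: "t > 0" for x t
      proof
        assume xt: "x + t *\<^sub>R v \<in> W m"
        \<comment> \<open>The truncated subtraction \<open>k - m\<close> is harmless, since the
          orbits matter only for \<open>k \<ge> m\<close>.\<close>
        define y where "y k = iterate_from T m (k - m) (x + t *\<^sub>R v)" for k
        define z where "z k = iterate_from T m (k - m) x" for k
        define e where "e k = (y k - z k) - S k *v (y k - z k)" for k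
        have orbit: "iterate_from T m (k - m) w \<in> C \<and> iterate_from T m (Suc k - m) w =
            iterate_from T m (k - m) w - \<alpha> k *\<^sub>R G (iterate_from T m (k - m) w) (\<xi> k \<omega>)"
          if "w \<in> W m" "k \<ge> m" for w k
          using that by (simp add: W_def Suc_diff_le T_def oracle_step_def)
        have "e m \<bullet> (H *v e m) \<le> 0"
        proof (rule trapped_difference[where \<eta> = \<eta>, OF _ \<open>\<tau> > 0\<close> assms(6,9)])
          show "norm (G u (\<xi> k \<omega>) - G w (\<xi> k \<omega>) - (A + J k) *v (u - w)) \<le> s * norm (u - w)"
            if "u \<in> C" "w \<in> C" for k u w
            unfolding AJ using lip \<xi> that by blast
          show "y k \<in> C \<and> y (Suc k) = y k - \<alpha> k *\<^sub>R G (y k) (\<xi> k \<omega>)" if "k \<ge> m" for k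
            unfolding y_def using orbit[OF xt that] .
          show "z k \<in> C \<and> z (Suc k) = z k - \<alpha> k *\<^sub>R G (z k) (\<xi> k \<omega>)" if "k \<ge> m" for k
            unfolding z_def using orbit[OF x that] .
          show "bounded C" by (simp add: C_def)
          show "\<alpha> k \<le> a\<^sub>0" "norm (S k) \<le> s" "norm (S (Suc k) ** J k) \<le> s" if "k \<ge> m" for k
            using m\<^sub>0[of k] m that by simp_all
        qed (rule expand S_rec s e_def | assumption)+
        \<comment> \<open>At time \<open>m\<close> no step has been taken and the orbits differ by
          exactly \<open>t *\<^sub>R v\<close>, so the form at \<open>e m\<close> is
          positive.\<close>
        moreover have "e m = t *\<^sub>R (v - S m *v v)"
          by (simp add: e_def y_def z_def matrix_vector_mult_scaleR scaleR_diff_right)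
        then have "e m \<bullet> (H *v e m) = t * (t * ((v - S m *v v) \<bullet> (H *v (v - S m *v v))))"
          by (simp only: matrix_vector_mult_scaleR inner_scaleR_left inner_scaleR_right)
        ultimately show False using m\<^sub>0[OF m] t by (simp add: mult_le_0_iff)
      qed
      ultimately have "negligible (W m)" using bdd by (intro negligible_if_thin_in_direction)
      then show ?thesis by (simp add: negligible_iff_null_sets)
    qed
    \<comment> \<open>Nullity is claimed for every \<open>m\<close>, hence the empty default before
      \<open>m\<^sub>0\<close>.\<close>
    define N where "N m = (if m \<ge> m\<^sub>0 then W m else {})" for m
    have "z m \<in> N m" if "m \<ge> m\<^sub>0" and z: "\<forall>k. z (Suc k) = z k - \<alpha> k *\<^sub>R G (z k) (\<xi> k \<omega>)"
      "\<forall>k\<ge>m. norm (z k - z\<^sub>s) \<le> \<delta>\<^sub>0" for m and z :: "nat \<Rightarrow> real^'n"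
    proof -
      have "iterate_from T m j (z m) = z (m + j)" for j
        using z(1) by (intro iterate_from_eq) (simp add: T_def oracle_step_def)
      then show ?thesis
        using that by (simp add: N_def W_def C_def dist_norm norm_minus_commute)
    qed
    moreover have "N m \<in> null_sets lebesgue" for m by (simp add: N_def null)
    ultimately show ?thesis by blast
  qed
  then show ?thesis using \<open>\<delta>\<^sub>0 > 0\<close> by blast
qed

end
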